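(* Let $X,Y\subset\mathbb{R}^N$ be compact sets, let $\mu\in\mathcal{P}(X)$, $\nu\in\mathcal{P}(Y)$, and let $c:X\times Y\to\mathbb{R}^+$ be a Borel cost function. For every transport class $\Lambda$ of $\Pi(\mu,\nu)$ one has $$M(\tilde c,\mu,\Lambda)=MK_\Lambda(c,\mu,\nu).$$
   Context: $\mathbb{R}^+=[0,+\infty)$. $\mathcal{P}(Z)$ denotes the set of Borel probability measures on $Z$. The set $\mathcal{P}(Y)$ is endowed with the $1$-Wasserstein distance $W(\nu_1,\nu_2)=\sup\{\int_Y\varphi\,d(\nu_1-\nu_2): \varphi:Y\to\mathbb{R}\ \text{1-Lipschitz}\}$, which metrizes the weak* topology, and with the corresponding Borel $\sigma$-algebra. A disintegration map is a map $f:X\to\mathcal{P}(Y)$ which is Borel in the sense that for every open $B\subset Y$ the function $x\mapsto f(x)(B)$ is Borel on $X$ (equivalently, $f$ is Borel measurable into $(\mathcal{P}(Y),W)$). For a disintegration map $f$, the measure $f\otimes\mu\in\mathcal{P}(X\times Y)$ is defined by $\int_{X\times Y}\varphi\,d(f\otimes\mu)=\int_X\left(\int_Y\varphi(x,y)\,df(x)(y)\right)d\mu(x)$ for all bounded continuous $\varphi$. $\Pi(\mu,\nu)$ is the set of measures in $\mathcal{P}(X\times Y)$ with first marginal $\mu$ and second marginal $\nu$. A transport class of $\Pi(\mu,\nu)$ is assigned by a Borel probability measure $\Lambda$ on $(\mathcal{P}(Y),W)$ satisfying $\int_{\mathcal{P}(Y)}\lambda\,d\Lambda(\lambda)=\nu$,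 i.e. $\int_{\mathcal{P}(Y)}\left(\int_Y\varphi\,d\lambda\right)d\Lambda(\lambda)=\int_Y\varphi\,d\nu$ for all continuous $\varphi:Y\to\mathbb{R}$; the transport class is identified with $\Lambda$ and consists of the plans $f\otimes\mu$ with $f$ a disintegration map such that $f_\#\mu=\Lambda$ (push-forward). The Monge-Kantorovich problem in the class $\Lambda$ is $$MK_\Lambda(c,\mu,\nu)=\inf\left\{\int_{X\times Y}c\,d\gamma\ :\ \gamma=f\otimes\mu,\ f_\#\mu=\Lambda\right\}.$$ The cost $\tilde c$ is defined on $X\times\mathcal{P}(Y)$ by $\tilde c(x,\lambda)=\int_Y c(x,y)\,d\lambda(y)$, and the abstract Monge problem is $$M(\tilde c,\mu,\Lambda)=\inf\left\{\int_X\tilde c(x,f(x))\,d\mu(x)\ :\ f:X\to\mathcal{P}(Y)\ \text{measurable},\ f_\#\mu=\Lambda\right\}.$$ The infimum over an empty set is $+\infty$. *)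

theory Defs
  imports "HOL-Probability.Probability"
begin

text \<open>The Borel probability measures on a set \<open>Z\<close>. They live on \<open>Z\<close> itself (their space is \<open>Z\<close>),
  not on the whole ambient type.\<close>

definition borel_probs :: "'a::topological_space set \<Rightarrow> 'a measure set" where
  "borel_probs Z = {\<nu>. prob_space \<nu> \<and> sets \<nu> = sets (restrict_space borel Z)}"

text \<open>Outside \<open>borel_probs Y\<close> the value \<open>0\<close> is a dummy: the library's locale of metric spaces asks
  for nonnegativity and symmetry on the whole type.\<close>

definition wasserstein :: "'a::metric_space set \<Rightarrow> 'a measure \<Rightarrow> 'a measure \<Rightarrow> real" where
  "wasserstein Y \<nu>1 \<nu>2 =
     (if \<nu>1 \<in> borel_probs Y \<and> \<nu>2 \<in> borel_probs Y
      then Sup {(\<integral>y. \<phi> y \<partial>\<nu>1) - (\<integral>y. \<phi> y \<partial>\<nu>2) | \<phi>::'a \<Rightarrow> real. 1-lipschitz_on Y \<phi>}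
      else 0)"

text \<open>For compact \<open>Y\<close> this is a genuine metric, so that the library's notion of metric topology
  applies.\<close>

lemma borel_probs_space: "\<nu> \<in> borel_probs Z \<Longrightarrow> space \<nu> = Z"
  by (auto simp: borel_probs_def space_restrict_space dest: sets_eq_imp_space_eq)

lemma borel_probs_integrable:
  fixes \<phi> :: "'a::metric_space \<Rightarrow> real"
  assumes "compact Z" "\<nu> \<in> borel_probs Z" "continuous_on Z \<phi>"
  shows "integrable \<nu> \<phi>"
proof -
  interpret prob_space \<nu> using assms by (simp add: borel_probs_def)
  have m: "\<phi> \<in> borel_measurable \<nu>"
    using borel_measurable_continuous_on_restrict[OF assms(3)] assms(2)
    by (simp add: borel_probs_def cong: measurable_cong_sets)
  have "bounded (\<phi> ` Z)" using assms compact_continuous_image compact_imp_bounded by blast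
  then obtain K where "\<And>z. z \<in> Z \<Longrightarrow> norm (\<phi> z) \<le> K" by (auto simp: bounded_iff)
  then show ?thesis using m borel_probs_space[OF assms(2)]
    by (intro integrable_const_bound[where B=K]) auto
qed

lemma Metric_space_wasserstein:
  fixes Y :: "'a::metric_space set"
  assumes Y: "compact Y"
  shows "Metric_space (borel_probs Y) (wasserstein Y)"
proof -
  define S where "S \<mu> \<nu> = {(\<integral>y. \<phi> y \<partial>\<mu>) - (\<integral>y. \<phi> y \<partial>\<nu>) | \<phi>::'a \<Rightarrow> real. 1-lipschitz_on Y \<phi>}" for \<mu> \<nu>
  have W: "wasserstein Y \<mu> \<nu> = Sup (S \<mu> \<nu>)" if "\<mu> \<in> borel_probs Y" "\<nu> \<in> borel_probs Y" for \<mu> \<nu>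
    using that by (simp add: wasserstein_def S_def)
  have int: "integrable \<nu> \<phi>" if "\<nu> \<in> borel_probs Y" "L-lipschitz_on Y \<phi>" for \<nu> L and \<phi> :: "'a \<Rightarrow> real"
    using that Y borel_probs_integrable lipschitz_on_continuous_on by blast
  have ne: "0 \<in> S \<mu> \<nu>" for \<mu> \<nu>
  proof -
    have "1-lipschitz_on Y (\<lambda>_. 0::real)" by (simp add: lipschitz_on_def)
    then show ?thesis unfolding S_def by force
  qed
  have sym: "S \<mu> \<nu> \<subseteq> S \<nu> \<mu>" for \<mu> \<nu>
  proof
    fix r assume "r \<in> S \<mu> \<nu>"
    then obtain \<phi> :: "'a \<Rightarrow> real" where p: "1-lipschitz_on Y \<phi>" "r = (\<integral>y. \<phi> y \<partial>\<mu>) - (\<integral>y. \<phi> y \<partial>\<nu>)" by (auto simp: S_def)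
    then have "1-lipschitz_on Y (\<lambda>y. - \<phi> y)" "r = (\<integral>y. - \<phi> y \<partial>\<nu>) - (\<integral>y. - \<phi> y \<partial>\<mu>)" by auto
    then show "r \<in> S \<nu> \<mu>" unfolding S_def by blast
  qed
  have bdd: "bdd_above (S \<mu> \<nu>)" if mn: "\<mu> \<in> borel_probs Y" "\<nu> \<in> borel_probs Y" for \<mu> \<nu>
  proof -
    interpret m: prob_space \<mu> using mn by (simp add: borel_probs_def)
    interpret n: prob_space \<nu> using mn by (simp add: borel_probs_def)
    obtain y0 where y0: "y0 \<in> Y" using m.not_empty borel_probs_space[OF mn(1)] by auto
    have "r \<le> 2 * diameter Y" if "r \<in> S \<mu> \<nu>" for r
    proof -
      obtain \<phi> :: "'a \<Rightarrow> real" where p: "1-lipschitz_on Y \<phi>" "r = (\<integral>y. \<phi> y \<partial>\<mu>) - (\<integral>y. \<phi> y \<partial>\<nu>)" using \<open>r \<in> _\<close> by (auto simp: S_def)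
      have b: "\<bar>\<phi> y - \<phi> y0\<bar> \<le> diameter Y" if "y \<in> Y" for y
        using lipschitz_onD[OF p(1) that y0] diameter_bounded_bound[OF compact_imp_bounded[OF Y] that y0]
        by (simp add: dist_real_def)
      have "(\<integral>y. \<phi> y \<partial>\<mu>) \<le> (\<integral>y. \<phi> y0 + diameter Y \<partial>\<mu>)"
        using b borel_probs_space[OF mn(1)] int[OF mn(1) p(1)] by (intro integral_mono) (auto simp: abs_le_iff algebra_simps)
      moreover have "(\<integral>y. \<phi> y0 - diameter Y \<partial>\<nu>) \<le> (\<integral>y. \<phi> y \<partial>\<nu>)"
        using b borel_probs_space[OF mn(2)] int[OF mn(2) p(1)] by (intro integral_mono) (auto simp: abs_le_iff algebra_simps)
      ultimately show ?thesis using p(2) by (simp add: m.prob_space n.prob_space)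
    qed
    then show ?thesis by (auto simp: bdd_above_def)
  qed
  have eq: "\<mu> = \<nu>" if mn: "\<mu> \<in> borel_probs Y" "\<nu> \<in> borel_probs Y" and 0: "Sup (S \<mu> \<nu>) = 0" for \<mu> \<nu>
  proof -
    interpret m: prob_space \<mu> using mn by (simp add: borel_probs_def)
    interpret n: prob_space \<nu> using mn by (simp add: borel_probs_def)
    have 1: "(\<integral>y. \<phi> y \<partial>\<mu>) = (\<integral>y. \<phi> y \<partial>\<nu>)" if "L-lipschitz_on Y \<phi>" for L and \<phi> :: "'a \<Rightarrow> real"
    proof -
      define K where "K = max L 1"
      have K: "K > 0" "K-lipschitz_on Y \<phi>" using that lipschitz_on_mono[OF that order_refl] by (auto simp: K_def)
      have l: "1-lipschitz_on Y (\<lambda>y. \<phi> y / K)"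
        using K by (auto simp: lipschitz_on_def dist_real_def diff_divide_distrib[symmetric] divide_le_eq mult.commute)
      then have "(\<integral>y. \<phi> y / K \<partial>\<mu>) - (\<integral>y. \<phi> y / K \<partial>\<nu>) \<in> S \<mu> \<nu>"  unfolding S_def by blast
      then have a: "(\<integral>y. \<phi> y / K \<partial>\<mu>) - (\<integral>y. \<phi> y / K \<partial>\<nu>) \<le> 0" 
        using cSup_upper[OF _ bdd[OF mn]] 0 by metis
      have "(\<integral>y. - (\<phi> y / K) \<partial>\<mu>) - (\<integral>y. - (\<phi> y / K) \<partial>\<nu>) \<in> S \<mu> \<nu>" using l lipschitz_on_minus[OF l] unfolding S_def by blast
      then have b: "(\<integral>y. - (\<phi> y / K) \<partial>\<mu>) - (\<integral>y. - (\<phi> y / K) \<partial>\<nu>) \<le> 0" 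
        using cSup_upper[OF _ bdd[OF mn]] 0 by metis
      from a b K show ?thesis by (simp add: field_simps)
    qed
    have cl: "emeasure \<mu> C = emeasure \<nu> C" if C: "closedin (top_of_set Y) C" for C
    proof (cases "C = {}")
      case False
      define \<phi> where "\<phi> n y = max 0 (1 - real n * infdist y C)" for n y
      have lip: "(real n)-lipschitz_on Y (\<phi> n)" for n
      proof (rule lipschitz_onI)
        fix x y 
        have "\<bar>real n * infdist x C - real n * infdist y C\<bar> \<le> real n * dist x y"
          using infdist_triangle_abs[of x C y] by (simp add: abs_mult right_diff_distrib[symmetric] mult_left_mono)
        then show "dist (\<phi> n x) (\<phi> n y) \<le> real n * dist x y"
          by (auto simp: \<phi>_def dist_real_def max_def abs_if split: if_splits)
      qed simp
      have CY: "C \<subseteq> Y" using C closedin_subset by fastforce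
      have "compact C" using C Y closedin_compact by blast
      then have ccl: "closed C" by (rule compact_imp_closed)
      have lim: "(\<lambda>n. \<phi> n y) \<longlonglongrightarrow> indicator C y" for y
      proof (cases "y \<in> C")
        case True then show ?thesis by (simp add: \<phi>_def)
      next
        case f: False
        then have d: "infdist y C > 0" using infdist_pos_not_in_closed[OF ccl False f] by simp
        obtain N where N: "1 < real N * infdist y C" using reals_Archimedean3[OF d] by auto
        have "\<forall>\<^sub>F n in sequentially. \<phi> n y = 0"
          unfolding eventually_sequentially
        proof (intro exI[of _ N] allI impI)
          fix n assume "N \<le> n"
          then have "real N * infdist y C \<le> real n * infdist y C" using d by (simp add: mult_right_mono)
          then show "\<phi> n y = 0" using N by (simp add: \<phi>_def)
        qed
        then show ?thesis using f by (simp add: tendsto_eventually)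
      qed
      have conv: "(\<lambda>n. \<integral>y. \<phi> n y \<partial>\<rho>) \<longlonglongrightarrow> measure \<rho> C" if r: "\<rho> \<in> borel_probs Y" for \<rho>
      proof -
        interpret r: prob_space \<rho> using r by (simp add: borel_probs_def)
        have Cs: "C \<in> sets \<rho>" using r ccl CY
          by (auto simp: borel_probs_def sets_restrict_space intro!: image_eqI[of _ _ C])
        have "(\<lambda>n. \<integral>y. \<phi> n y \<partial>\<rho>) \<longlonglongrightarrow> (\<integral>y. indicator C y \<partial>\<rho>)"
        proof (rule integral_dominated_convergence[where w="\<lambda>_. 1"])
          show "AE x in \<rho>. norm (\<phi> i x) \<le> 1" for i
            by (auto simp: \<phi>_def infdist_nonneg)
          show "AE x in \<rho>. (\<lambda>i. \<phi> i x) \<longlonglongrightarrow> indicator C x" using lim by simp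
          show "\<phi> i \<in> borel_measurable \<rho>" for i using int[OF r lip] by auto
        qed (use Cs in auto)
        then show ?thesis using Cs by simp
      qed
      have "measure \<mu> C = measure \<nu> C"
        using conv[OF mn(1)] conv[OF mn(2)] 1[OF lip] LIMSEQ_unique by simp
      then show ?thesis by (simp add: m.emeasure_eq_measure n.emeasure_eq_measure)
    qed simp
    let ?E = "{C. closedin (top_of_set Y) C}"
    have st: "sets (restrict_space borel Y) = sigma_sets Y ?E"
    proof -
      have "sets (restrict_space borel Y) = sigma_sets Y ((\<inter>) Y ` Collect closed)"
        by (simp add: borel_eq_closed sets_restrict_space)
           (subst sigma_sets_Int[symmetric], auto intro!: sigma_sets.Basic compact_imp_closed[OF Y])
      also have "(\<inter>) Y ` Collect closed = ?E" by (auto simp: closedin_closed)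
      finally show ?thesis .
    qed
    show ?thesis
    proof (rule measure_eqI_generator_eq[where E="?E" and \<Omega>=Y and A="\<lambda>_. Y"])
      show "Int_stable ?E" by (auto simp: Int_stable_def)
      show "?E \<subseteq> Pow Y" using closedin_subset by fastforce
    qed (use mn st cl in \<open>auto simp: borel_probs_def\<close>)
  qed
  show ?thesis
  proof
    fix \<mu> \<nu> \<rho> :: "'a measure"
    show "0 \<le> wasserstein Y \<mu> \<nu>"
      using cSup_upper[OF ne bdd] W by (cases "\<mu> \<in> borel_probs Y \<and> \<nu> \<in> borel_probs Y") (auto simp: wasserstein_def)
    show "wasserstein Y \<mu> \<nu> = wasserstein Y \<nu> \<mu>"
      using W[of \<mu> \<nu>] W[of \<nu> \<mu>] subset_antisym[OF sym[of \<mu> \<nu>] sym[of \<nu> \<mu>]]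
      by (cases "\<mu> \<in> borel_probs Y \<and> \<nu> \<in> borel_probs Y") (simp, auto simp: wasserstein_def)
    assume m: "\<mu> \<in> borel_probs Y" and n: "\<nu> \<in> borel_probs Y"
    have "S \<mu> \<mu> = {0}" using ne[of \<mu> \<mu>] by (auto simp: S_def)
    then show "wasserstein Y \<mu> \<nu> = 0 \<longleftrightarrow> \<mu> = \<nu>" using W m n eq by auto
    assume r: "\<rho> \<in> borel_probs Y"
    have "Sup (S \<mu> \<rho>) \<le> Sup (S \<mu> \<nu>) + Sup (S \<nu> \<rho>)"
    proof (rule cSup_least)
      show "S \<mu> \<rho> \<noteq> {}" using ne by auto
      fix t assume "t \<in> S \<mu> \<rho>"
      then obtain \<phi> :: "'a \<Rightarrow> real" where p: "1-lipschitz_on Y \<phi>" "t = (\<integral>y. \<phi> y \<partial>\<mu>) - (\<integral>y. \<phi> y \<partial>\<rho>)" by (auto simp: S_def)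
      have "(\<integral>y. \<phi> y \<partial>\<mu>) - (\<integral>y. \<phi> y \<partial>\<nu>) \<le> Sup (S \<mu> \<nu>)"
        by (rule cSup_upper[OF _ bdd[OF m n]]) (unfold S_def, use p in blast)
      moreover have "(\<integral>y. \<phi> y \<partial>\<nu>) - (\<integral>y. \<phi> y \<partial>\<rho>) \<le> Sup (S \<nu> \<rho>)"
        by (rule cSup_upper[OF _ bdd[OF n r]]) (unfold S_def, use p in blast)
      ultimately show "t \<le> Sup (S \<mu> \<nu>) + Sup (S \<nu> \<rho>)" using p(2) by simp
    qed
    then show "wasserstein Y \<mu> \<rho> \<le> wasserstein Y \<mu> \<nu> + wasserstein Y \<nu> \<rho>" using W m n r by simp
  qed
qed

definition wasserstein_borel :: "'a::metric_space set \<Rightarrow> 'a measure measure" where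
  "wasserstein_borel Y =
     sigma (borel_probs Y)
       {U. openin (Metric_space.mtopology (borel_probs Y) (wasserstein Y)) U}"

definition disintegration_map ::
    "'a::topological_space set \<Rightarrow> 'b::topological_space set \<Rightarrow> ('a \<Rightarrow> 'b measure) \<Rightarrow> bool" where
  "disintegration_map X Y f \<longleftrightarrow>
     f \<in> X \<rightarrow> borel_probs Y \<and>
     (\<forall>B. openin (top_of_set Y) B \<longrightarrow>
        (\<lambda>x. measure (f x) B) \<in> borel_measurable (restrict_space borel X))"

text \<open>The measure \<open>f \<otimes> \<mu>\<close> on \<open>X \<times> Y\<close>, determined by its integrals of bounded continuous functions.\<close>

definition disint_prod ::
    "'a::topological_space set \<Rightarrow> 'b::topological_space set \<Rightarrow> ('a \<Rightarrow> 'b measure) \<Rightarrow> 'a measure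
      \<Rightarrow> ('a \<times> 'b) measure" where
  "disint_prod X Y f \<mu> =
     (THE \<gamma>. \<gamma> \<in> borel_probs (X \<times> Y) \<and>
        (\<forall>\<phi>::'a \<times> 'b \<Rightarrow> real. continuous_on (X \<times> Y) \<phi> \<and> bounded (\<phi> ` (X \<times> Y)) \<longrightarrow>
           (\<integral>z. \<phi> z \<partial>\<gamma>) = (\<integral>x. (\<integral>y. \<phi> (x, y) \<partial>f x) \<partial>\<mu>)))"

text \<open>A transport class is represented by the measure \<open>\<Lambda>\<close> assigning it; the plans it consists of
  are collected in \<open>class_plans\<close>, which may be empty.\<close>

definition transport_class :: "'b::metric_space set \<Rightarrow> 'b measure \<Rightarrow> 'b measure measure \<Rightarrow> bool" where
  "transport_class Y \<nu> \<Lambda> \<longleftrightarrow>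
     prob_space \<Lambda> \<and> sets \<Lambda> = sets (wasserstein_borel Y) \<and>
     (\<forall>\<phi>::'b \<Rightarrow> real. continuous_on Y \<phi> \<longrightarrow>
        (\<integral>\<rho>. (\<integral>y. \<phi> y \<partial>\<rho>) \<partial>\<Lambda>) = (\<integral>y. \<phi> y \<partial>\<nu>))"

definition class_plans ::
    "'a::metric_space set \<Rightarrow> 'b::metric_space set \<Rightarrow> 'a measure \<Rightarrow> 'b measure measure
      \<Rightarrow> ('a \<times> 'b) measure set" where
  "class_plans X Y \<mu> \<Lambda> =
     {disint_prod X Y f \<mu> | f.
        disintegration_map X Y f \<and> distr \<mu> (wasserstein_borel Y) f = \<Lambda>}"

text \<open>Costs are nonnegative but possibly unbounded, hence all total costs are taken in \<open>[0, \<infinity>]\<close>,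
  where the infimum of the empty set is \<open>\<infinity>\<close>.\<close>

definition MK_class ::
    "'a::metric_space set \<Rightarrow> 'b::metric_space set \<Rightarrow> ('a \<times> 'b \<Rightarrow> real) \<Rightarrow> 'a measure
      \<Rightarrow> 'b measure measure \<Rightarrow> ennreal" where
  "MK_class X Y c \<mu> \<Lambda> = (INF \<gamma>\<in>class_plans X Y \<mu> \<Lambda>. \<integral>\<^sup>+z. ennreal (c z) \<partial>\<gamma>)"

definition cost_tilde :: "('a \<times> 'b \<Rightarrow> real) \<Rightarrow> 'a \<Rightarrow> 'b measure \<Rightarrow> ennreal" where
  "cost_tilde c x \<rho> = (\<integral>\<^sup>+y. ennreal (c (x, y)) \<partial>\<rho>)"

definition abstract_Monge ::
    "'b::metric_space set \<Rightarrow> ('a \<Rightarrow> 'b measure \<Rightarrow> ennreal) \<Rightarrow> 'a measure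
      \<Rightarrow> 'b measure measure \<Rightarrow> ennreal" where
  "abstract_Monge Y C \<mu> \<Lambda> =
     (INF f\<in>{f. f \<in> measurable \<mu> (wasserstein_borel Y) \<and> distr \<mu> (wasserstein_borel Y) f = \<Lambda>}.
        \<integral>\<^sup>+x. C x (f x) \<partial>\<mu>)"

end

theory Submission
  imports Defs
begin

text \<open>The two infima run over the same maps and minimise the same number.

  \<^item> The maps: \<open>f\<close> is a disintegration map iff it is measurable into the Wasserstein space
    (\<open>disintegration_map_iff_measurable\<close>). This is the substance of the proof. It holds because the
    Borel \<open>\<sigma>\<close>-algebra of the distance \<open>W\<close> on the probability measures on a compact \<open>Y\<close> is the Giry
    \<open>\<sigma>\<close>-algebra \<open>prob_algebra\<close>, generated by the evaluations \<open>\<rho> \<mapsto> \<rho> B\<close>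
    (\<open>sets_wasserstein_borel_eq_prob_algebra\<close>). An evaluation on an open set is a limit of multiples
    of integrals of 1-Lipschitz functions, and these integrals are continuous for \<open>W\<close>. Conversely,
    the 1-Lipschitz functions on \<open>Y\<close> are totally bounded modulo constants
    (\<open>finite_net_lipschitz\<close>), so that \<open>W\<close> is controlled up to \<open>\<epsilon>\<close> by finitely many integrals.
    Every \<open>W\<close>-open set is therefore a countable union of sets cut out by the integer parts of finitely
    many multiples of integrals.

  \<^item> The values: for a disintegration map \<open>f\<close>, the plan \<open>f \<otimes> \<mu>\<close> is the Giry bind of \<open>\<mu>\<close> with the
    kernel \<open>x \<mapsto> \<delta>\<^sub>x \<otimes> f x\<close>, since a Borel probability measure on the compact set \<open>X \<times> Y\<close> is
    determined by its integrals of continuous functions. Tonelli for the bind extends the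
    defining formula of \<open>f \<otimes> \<mu>\<close> from continuous functions to Borel nonnegative ones
    (\<open>nn_integral_disint_prod\<close>). At \<open>c\<close> this says that the cost of the plan
    \<open>f \<otimes> \<mu>\<close> is the integral of \<open>x \<mapsto> cost_tilde c x (f x)\<close>.\<close>

section \<open>Borel \<open>\<sigma>\<close>-algebras of subsets and products\<close>

lemma sets_pair_restrict_borel:
  fixes X :: "'a::second_countable_topology set" and Y :: "'b::second_countable_topology set"
  shows "sets (restrict_space borel X \<Otimes>\<^sub>M restrict_space borel Y) = sets (restrict_space borel (X \<times> Y))"
    (is "sets ?P = sets ?R")
proof
  have sp: "space ?P = X \<times> Y" by (simp add: space_pair_measure space_restrict_space)
  have "(\<lambda>z. (fst z, snd z)) \<in> ?R \<rightarrow>\<^sub>M ?P"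
    by (intro measurable_Pair measurable_restrict_space2)
       (auto simp: space_restrict_space intro!: measurable_restrict_space1 borel_measurable_continuous_onI continuous_intros)
  then have id1: "id \<in> ?R \<rightarrow>\<^sub>M ?P" by (simp add: id_def)
  show "sets ?P \<subseteq> sets ?R"
  proof
    fix S assume S: "S \<in> sets ?P"
    from measurable_sets[OF id1 S] show "S \<in> sets ?R"
      using sets.sets_into_space[OF S] sp by (simp add: space_restrict_space Int_absorb2)
  qed
  have "(\<lambda>z. (fst z, snd z)) \<in> ?P \<rightarrow>\<^sub>M borel \<Otimes>\<^sub>M borel"
    by (intro measurable_Pair measurable_compose[OF measurable_fst]
        measurable_compose[OF measurable_snd] measurable_restrict_space1) auto
  then have id2: "id \<in> ?P \<rightarrow>\<^sub>M borel" by (simp add: id_def borel_prod)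
  show "sets ?R \<subseteq> sets ?P"
    using measurable_sets[OF id2] sp by (auto simp: sets_restrict_space Int_commute)
qed

lemma sets_restrict_borel_openin:
  fixes Y :: "'a::topological_space set"
  assumes "Y \<in> sets borel"
  shows "sets (restrict_space borel Y) = sigma_sets Y {B. openin (top_of_set Y) B}"
proof -
  have "sets (restrict_space borel Y) = sigma_sets Y ((\<inter>) Y ` Collect open)"
    using assms by (simp add: borel_def sets_restrict_space)
       (subst sigma_sets_Int[symmetric], auto)
  also have "(\<inter>) Y ` Collect open = {B. openin (top_of_set Y) B}" by (auto simp: openin_open)
  finally show ?thesis .
qed

section \<open>Lipschitz functions and the Wasserstein distance\<close>

text \<open>A cheap form of the Arzela-Ascoli theorem. Record, on a finite net of points of \<open>Y\<close>, the
  increments \<open>\<psi> z - \<psi> y0\<close> rounded to multiples of \<open>e / 3\<close>. Only finitely many records occur, and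
  two functions with the same record differ by a constant up to \<open>e\<close>; so it is enough to keep one
  function for each record.\<close>

lemma finite_net_lipschitz:
  fixes Y :: "'a::metric_space set"
  assumes "compact Y" "e > 0"
  obtains F :: "('a \<Rightarrow> real) set" where "finite F" "\<And>\<phi>. \<phi> \<in> F \<Longrightarrow> 1-lipschitz_on Y \<phi>"
    "\<And>\<psi>. 1-lipschitz_on Y \<psi> \<Longrightarrow> \<exists>\<phi>\<in>F. \<exists>a. \<forall>y\<in>Y. \<bar>\<psi> y - \<phi> y - a\<bar> \<le> e"
proof (cases "Y = {}")
  case True
  then show ?thesis by (intro that[of "{\<lambda>_. 0}"]) auto
next
  case False
  then obtain y0 where y0: "y0 \<in> Y" by auto
  define d where "d = e / 3"
  have d: "d > 0" using assms by (simp add: d_def)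
  obtain N where N: "finite N" "N \<subseteq> Y" "Y \<subseteq> (\<Union>x\<in>N. ball x d)"
    using seq_compact_imp_totally_bounded assms(1) d unfolding compact_eq_seq_compact_metric by metis
  define L :: "('a \<Rightarrow> real) set" where "L = {\<psi>. 1-lipschitz_on Y \<psi>}"
  define key where "key \<psi> = restrict (\<lambda>z. \<lfloor>(\<psi> z - \<psi> y0) / d\<rfloor>) N" for \<psi> :: "'a \<Rightarrow> real"
  define D where "D = diameter Y"
  have "key ` L \<subseteq> PiE N (\<lambda>_. {\<lfloor>- D / d\<rfloor>..\<lfloor>D / d\<rfloor>})"
  proof (clarsimp simp: key_def L_def)
    fix \<psi> :: "'a \<Rightarrow> real" and z assume l: "1-lipschitz_on Y \<psi>" and z: "z \<in> N"
    have "\<bar>\<psi> z - \<psi> y0\<bar> \<le> D"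
      using lipschitz_onD[OF l, of z y0] diameter_bounded_bound[OF compact_imp_bounded[OF assms(1)], of z y0] z N y0
      by (auto simp: dist_real_def D_def)
    then have "- D / d \<le> (\<psi> z - \<psi> y0) / d" "(\<psi> z - \<psi> y0) / d \<le> D / d"
      using d by (intro divide_right_mono; linarith)+
    then show "\<lfloor>- (D / d)\<rfloor> \<le> \<lfloor>(\<psi> z - \<psi> y0) / d\<rfloor> \<and> \<lfloor>(\<psi> z - \<psi> y0) / d\<rfloor> \<le> \<lfloor>D / d\<rfloor>"
      by (auto intro!: floor_mono)
  qed
  then have "finite (key ` L)" by (rule finite_subset) (use N in \<open>auto intro!: finite_PiE\<close>)
  then obtain F where F: "F \<subseteq> L" "finite F" "key ` L = key ` F"
    by (rule finite_subset_image[OF _ order_refl, THEN exE]) auto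
  show ?thesis
  proof (rule that[OF F(2)])
    fix \<psi> :: "'a \<Rightarrow> real" assume \<psi>: "1-lipschitz_on Y \<psi>"
    then have "key \<psi> \<in> key ` F" using F by (auto simp: L_def)
    then obtain \<phi> where \<phi>: "\<phi> \<in> F" "key \<psi> = key \<phi>" by auto
    have \<phi>l: "1-lipschitz_on Y \<phi>" using \<phi> F by (auto simp: L_def)
    \<comment> \<open>One third of \<open>e\<close> is lost at the net point \<open>z\<close>, one in moving each function from \<open>z\<close> to \<open>y\<close>.\<close>
    have "\<bar>\<psi> y - \<phi> y - (\<psi> y0 - \<phi> y0)\<bar> \<le> e" if y: "y \<in> Y" for y
    proof -
      obtain z where z: "z \<in> N" "dist z y < d" using N y by auto
      have "\<lfloor>(\<psi> z - \<psi> y0) / d\<rfloor> = \<lfloor>(\<phi> z - \<phi> y0) / d\<rfloor>"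
        using fun_cong[OF \<phi>(2), of z] z by (simp add: key_def)
      then have "\<bar>(\<psi> z - \<psi> y0) / d - (\<phi> z - \<phi> y0) / d\<bar> < 1" by linarith
      then have "\<bar>(\<psi> z - \<psi> y0) - (\<phi> z - \<phi> y0)\<bar> < d"
        using d by (simp add: diff_divide_distrib[symmetric] divide_less_eq)
      moreover have "\<bar>\<psi> z - \<psi> y\<bar> \<le> d" "\<bar>\<phi> z - \<phi> y\<bar> \<le> d"
        using lipschitz_onD[OF \<psi>, of z y] lipschitz_onD[OF \<phi>l, of z y] z N y by (auto simp: dist_real_def)
      ultimately show ?thesis unfolding d_def by linarith
    qed
    then show "\<exists>\<phi>\<in>F. \<exists>a. \<forall>y\<in>Y. \<bar>\<psi> y - \<phi> y - a\<bar> \<le> e" using \<phi> by blast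
  qed (use F in \<open>auto simp: L_def\<close>)
qed

lemma borel_probs_integrable_lipschitz:
  fixes \<phi> :: "'a::metric_space \<Rightarrow> real"
  assumes "compact Y" "\<nu> \<in> borel_probs Y" "L-lipschitz_on Y \<phi>"
  shows "integrable \<nu> \<phi>"
  using assms borel_probs_integrable lipschitz_on_continuous_on by blast

text \<open>The additive constant \<open>a\<close> is free because it cancels between two probability measures.\<close>

lemma integral_diff_near:
  fixes \<psi> \<phi> :: "'a::metric_space \<Rightarrow> real"
  assumes Y: "compact Y" and m: "\<mu> \<in> borel_probs Y" and n: "\<nu> \<in> borel_probs Y"
    and \<psi>: "1-lipschitz_on Y \<psi>" and \<phi>: "1-lipschitz_on Y \<phi>"
    and near: "\<And>y. y \<in> Y \<Longrightarrow> \<bar>\<psi> y - \<phi> y - a\<bar> \<le> e"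
  shows "(\<integral>y. \<psi> y \<partial>\<mu>) - (\<integral>y. \<psi> y \<partial>\<nu>) \<le> (\<integral>y. \<phi> y \<partial>\<mu>) - (\<integral>y. \<phi> y \<partial>\<nu>) + 2 * e"
proof -
  interpret m: prob_space \<mu> using m by (simp add: borel_probs_def)
  interpret n: prob_space \<nu> using n by (simp add: borel_probs_def)
  note [simp] = borel_probs_integrable_lipschitz[OF Y m \<psi>] borel_probs_integrable_lipschitz[OF Y m \<phi>]
    borel_probs_integrable_lipschitz[OF Y n \<psi>] borel_probs_integrable_lipschitz[OF Y n \<phi>]
  have "(\<integral>y. \<psi> y \<partial>\<mu>) \<le> (\<integral>y. \<phi> y + (a + e) \<partial>\<mu>)"
    using near borel_probs_space[OF m] by (intro integral_mono) (auto simp: abs_le_iff algebra_simps)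
  moreover have "(\<integral>y. \<phi> y + (a - e) \<partial>\<nu>) \<le> (\<integral>y. \<psi> y \<partial>\<nu>)"
    using near borel_probs_space[OF n] by (intro integral_mono) (auto simp: abs_le_iff algebra_simps)
  ultimately show ?thesis by (simp add: m.prob_space n.prob_space)
qed

text \<open>The content is that the supremum defining the distance is over a set bounded above; the
  finite net with \<open>e = 1\<close> provides the bound.\<close>

lemma lipschitz_integral_diff_le_wasserstein:
  fixes \<psi> :: "'a::metric_space \<Rightarrow> real"
  assumes Y: "compact Y" and m: "\<mu> \<in> borel_probs Y" and n: "\<nu> \<in> borel_probs Y"
    and \<psi>: "1-lipschitz_on Y \<psi>"
  shows "\<bar>(\<integral>y. \<psi> y \<partial>\<mu>) - (\<integral>y. \<psi> y \<partial>\<nu>)\<bar> \<le> wasserstein Y \<mu> \<nu>"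
proof -
  define S where "S = {(\<integral>y. \<phi> y \<partial>\<mu>) - (\<integral>y. \<phi> y \<partial>\<nu>) | \<phi>::'a \<Rightarrow> real. 1-lipschitz_on Y \<phi>}"
  have W: "wasserstein Y \<mu> \<nu> = Sup S" using m n by (simp add: wasserstein_def S_def)
  obtain F :: "('a \<Rightarrow> real) set" where F: "finite F" "\<And>\<phi>. \<phi> \<in> F \<Longrightarrow> 1-lipschitz_on Y \<phi>"
    "\<And>\<psi>. 1-lipschitz_on Y \<psi> \<Longrightarrow> \<exists>\<phi>\<in>F. \<exists>a. \<forall>y\<in>Y. \<bar>\<psi> y - \<phi> y - a\<bar> \<le> 1"
    using finite_net_lipschitz[OF Y, of 1] by (metis zero_less_one)
  have bdd: "bdd_above S"
  proof (rule bdd_aboveI)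
    fix t assume "t \<in> S"
    then obtain \<psi> where l: "1-lipschitz_on Y \<psi>" and t: "t = (\<integral>y. \<psi> y \<partial>\<mu>) - (\<integral>y. \<psi> y \<partial>\<nu>)"
      by (auto simp: S_def)
    obtain \<phi> a where \<phi>: "\<phi> \<in> F" "\<forall>y\<in>Y. \<bar>\<psi> y - \<phi> y - a\<bar> \<le> 1" using F(3)[OF l] by blast
    have "t \<le> (\<integral>y. \<phi> y \<partial>\<mu>) - (\<integral>y. \<phi> y \<partial>\<nu>) + 2"
      using integral_diff_near[OF Y m n l F(2)[OF \<phi>(1)], of a 1] \<phi> t by simp
    also have "\<dots> \<le> Max ((\<lambda>\<phi>. (\<integral>y. \<phi> y \<partial>\<mu>) - (\<integral>y. \<phi> y \<partial>\<nu>)) ` F) + 2"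
      using F(1) \<phi>(1) by simp
    finally show "t \<le> Max ((\<lambda>\<phi>. (\<integral>y. \<phi> y \<partial>\<mu>) - (\<integral>y. \<phi> y \<partial>\<nu>)) ` F) + 2" .
  qed
  have "(\<integral>y. \<psi> y \<partial>\<mu>) - (\<integral>y. \<psi> y \<partial>\<nu>) \<in> S" using \<psi> unfolding S_def by blast
  moreover have "(\<integral>y. - \<psi> y \<partial>\<mu>) - (\<integral>y. - \<psi> y \<partial>\<nu>) \<in> S"
    using lipschitz_on_minus[OF \<psi>] unfolding S_def by blast
  ultimately show ?thesis
    using cSup_upper[OF _ bdd] unfolding W by (force simp: abs_le_iff)
qed

text \<open>For a finite net \<open>F\<close>, finitely many integrals certify that two measures are close. Of the
  bound \<open>3 * e\<close>, one \<open>e\<close> comes from the member of \<open>F\<close> and two from replacing \<open>\<psi>\<close> by it under both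
  measures.\<close>

lemma wasserstein_leI:
  fixes Y :: "'a::metric_space set"
  assumes Y: "compact Y" and m: "\<mu> \<in> borel_probs Y" and n: "\<nu> \<in> borel_probs Y"
    and F: "\<And>\<phi>. \<phi> \<in> F \<Longrightarrow> 1-lipschitz_on Y \<phi>"
    and net: "\<And>\<psi>. 1-lipschitz_on Y \<psi> \<Longrightarrow> \<exists>\<phi>\<in>F. \<exists>a. \<forall>y\<in>Y. \<bar>\<psi> y - \<phi> y - a\<bar> \<le> e"
    and close: "\<And>\<phi>. \<phi> \<in> F \<Longrightarrow> (\<integral>y. \<phi> y \<partial>\<mu>) - (\<integral>y. \<phi> y \<partial>\<nu>) \<le> e"
  shows "wasserstein Y \<mu> \<nu> \<le> 3 * e"
proof -
  have "Sup {(\<integral>y. \<psi> y \<partial>\<mu>) - (\<integral>y. \<psi> y \<partial>\<nu>) | \<psi>::'a \<Rightarrow> real. 1-lipschitz_on Y \<psi>} \<le> 3 * e"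
  proof (rule cSup_least)
    have "1-lipschitz_on Y (\<lambda>_. 0::real)" by (simp add: lipschitz_on_def)
    then show "{(\<integral>y. \<psi> y \<partial>\<mu>) - (\<integral>y. \<psi> y \<partial>\<nu>) | \<psi>::'a \<Rightarrow> real. 1-lipschitz_on Y \<psi>} \<noteq> {}"
      by blast
    fix t assume "t \<in> {(\<integral>y. \<psi> y \<partial>\<mu>) - (\<integral>y. \<psi> y \<partial>\<nu>) | \<psi>::'a \<Rightarrow> real. 1-lipschitz_on Y \<psi>}"
    then obtain \<psi> where l: "1-lipschitz_on Y \<psi>" and t: "t = (\<integral>y. \<psi> y \<partial>\<mu>) - (\<integral>y. \<psi> y \<partial>\<nu>)"
      by blast
    obtain \<phi> a where \<phi>: "\<phi> \<in> F" "\<forall>y\<in>Y. \<bar>\<psi> y - \<phi> y - a\<bar> \<le> e" using net[OF l] by blast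
    show "t \<le> 3 * e"
      using integral_diff_near[OF Y m n l F[OF \<phi>(1)], of a e] \<phi> t close[OF \<phi>(1)] by simp
  qed
  then show ?thesis using m n by (simp add: wasserstein_def)
qed

text \<open>Equality of the integrals of continuous functions makes \<open>W\<close> vanish, and \<open>W\<close> is a metric.\<close>

lemma borel_probs_eqI:
  fixes Z :: "'a::metric_space set"
  assumes Z: "compact Z" and m: "\<mu> \<in> borel_probs Z" and n: "\<nu> \<in> borel_probs Z"
    and eq: "\<And>\<phi>::'a \<Rightarrow> real. continuous_on Z \<phi> \<Longrightarrow> (\<integral>z. \<phi> z \<partial>\<mu>) = (\<integral>z. \<phi> z \<partial>\<nu>)"
  shows "\<mu> = \<nu>"
proof -
  interpret W: Metric_space "borel_probs Z" "wasserstein Z" by (rule Metric_space_wasserstein[OF Z])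
  have "wasserstein Z \<mu> \<nu> \<le> 3 * 0"
  proof (rule wasserstein_leI[OF Z m n, where F="{\<phi>. 1-lipschitz_on Z \<phi>}"])
    show "\<exists>\<phi>\<in>{\<phi>. 1-lipschitz_on Z \<phi>}. \<exists>a. \<forall>y\<in>Z. \<bar>\<psi> y - \<phi> y - a\<bar> \<le> 0" if "1-lipschitz_on Z \<psi>" for \<psi> :: "'a \<Rightarrow> real"
      using that by (intro bexI[of _ \<psi>] exI[of _ 0]) auto
  qed (use eq lipschitz_on_continuous_on in force)+
  then have "wasserstein Z \<mu> \<nu> = 0" using W.nonneg[of \<mu> \<nu>] by linarith
  then show ?thesis using W.zero m n by blast
qed

section \<open>The Wasserstein and the Giry \<open>\<sigma>\<close>-algebra\<close>

lemma space_wasserstein_borel: "space (wasserstein_borel Y) = borel_probs Y"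
  by (simp add: wasserstein_borel_def space_measure_of_conv)

lemma sets_wasserstein_borel:
  assumes "compact Y"
  shows "sets (wasserstein_borel Y) = sigma_sets (borel_probs Y)
       {U. openin (Metric_space.mtopology (borel_probs Y) (wasserstein Y)) U}"
proof -
  interpret W: Metric_space "borel_probs Y" "wasserstein Y" by (rule Metric_space_wasserstein[OF assms])
  show ?thesis unfolding wasserstein_borel_def
    by (rule sets_measure_of) (use openin_subset in fastforce)
qed

lemma space_prob_algebra_restrict_borel:
  "space (prob_algebra (restrict_space borel Y)) = borel_probs Y"
  by (auto simp: space_prob_algebra borel_probs_def)

lemma measurable_lipschitz_integral_wasserstein:
  fixes \<psi> :: "'a::metric_space \<Rightarrow> real"
  assumes Y: "compact Y" and \<psi>: "1-lipschitz_on Y \<psi>"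
  shows "(\<lambda>\<rho>. \<integral>y. \<psi> y \<partial>\<rho>) \<in> borel_measurable (wasserstein_borel Y)"
proof (rule borel_measurableI)
  interpret W: Metric_space "borel_probs Y" "wasserstein Y" by (rule Metric_space_wasserstein[OF Y])
  fix S :: "real set" assume S: "open S"
  let ?U = "(\<lambda>\<rho>. \<integral>y. \<psi> y \<partial>\<rho>) -` S \<inter> borel_probs Y"
  have "openin W.mtopology ?U" unfolding W.openin_mtopology
  proof (intro conjI allI impI)
    fix \<rho> assume r: "\<rho> \<in> ?U"
    then obtain e where e: "e > 0" "\<And>t. dist t (\<integral>y. \<psi> y \<partial>\<rho>) < e \<Longrightarrow> t \<in> S"
      using S unfolding open_dist by auto
    have "W.mball \<rho> e \<subseteq> ?U"
    proof
      fix \<sigma> assume s: "\<sigma> \<in> W.mball \<rho> e"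
      then have "\<bar>(\<integral>y. \<psi> y \<partial>\<rho>) - (\<integral>y. \<psi> y \<partial>\<sigma>)\<bar> < e"
        using lipschitz_integral_diff_le_wasserstein[OF Y _ _ \<psi>, of \<rho> \<sigma>] by (auto simp: W.in_mball)
      then show "\<sigma> \<in> ?U" using s e(2) by (auto simp: W.in_mball dist_real_def abs_minus_commute)
    qed
    then show "\<exists>r>0. W.mball \<rho> r \<subseteq> ?U" using e by blast
  qed auto
  then show "(\<lambda>\<rho>. \<integral>y. \<psi> y \<partial>\<rho>) -` S \<inter> space (wasserstein_borel Y) \<in> sets (wasserstein_borel Y)"
    unfolding sets_wasserstein_borel[OF Y] space_wasserstein_borel by (intro sigma_sets.Basic) simp
qed

text \<open>The indicator of \<open>B\<close> is the increasing limit of \<open>min 1 ((n + 1) d(y, Y - B))\<close>. The factor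
  \<open>n + 1\<close> stands outside the integral so that the integrand is 1-Lipschitz. The case
  \<open>B = Y\<close> is excluded because \<open>infdist y {}\<close> is \<open>0\<close> by convention.\<close>

lemma measure_relatively_open_limit:
  fixes Y :: "'a::metric_space set"
  assumes Y: "compact Y" and r: "\<rho> \<in> borel_probs Y" and B: "openin (top_of_set Y) B" "B \<noteq> Y"
  shows "(\<lambda>n. real (Suc n) * (\<integral>y. min (1 / real (Suc n)) (infdist y (Y - B)) \<partial>\<rho>)) \<longlonglongrightarrow> measure \<rho> B"
proof -
  interpret r: prob_space \<rho> using r by (simp add: borel_probs_def)
  let ?C = "Y - B" let ?\<phi> = "\<lambda>n y. real (Suc n) * min (1 / real (Suc n)) (infdist y ?C)"
  have BY: "B \<subseteq> Y" using B openin_subset by fastforce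
  then have C: "?C \<noteq> {}" using B by auto
  have "closedin (top_of_set Y) ?C" using B by (auto intro: openin_closedin_eq[THEN iffD1, THEN conjunct2] simp: openin_closedin_eq)
  then have "closed ?C" using Y closedin_compact compact_imp_closed by blast
  have Bs: "B \<in> sets \<rho>" using r sets_restrict_borel_openin[of Y] B Y
    by (auto simp: borel_probs_def compact_imp_closed)
  have lim: "(\<lambda>n. ?\<phi> n y) \<longlonglongrightarrow> indicator B y" if y: "y \<in> Y" for y
  proof (cases "y \<in> B")
    case False
    then show ?thesis using y by simp
  next
    case True
    then have d: "infdist y ?C > 0" using infdist_pos_not_in_closed[OF \<open>closed ?C\<close> C] by simp
    obtain N where N: "1 < real N * infdist y ?C" using reals_Archimedean3[OF d] by auto
    have "\<forall>\<^sub>F n in sequentially. ?\<phi> n y = 1"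
      unfolding eventually_sequentially
    proof (intro exI[of _ N] allI impI)
      fix n assume "N \<le> n"
      then have "real N * infdist y ?C \<le> real (Suc n) * infdist y ?C" using d by (intro mult_right_mono) auto
      then have "1 / real (Suc n) \<le> infdist y ?C" using N by (simp add: divide_le_eq mult.commute)
      then show "?\<phi> n y = 1" by (simp add: min_def)
    qed
    then show ?thesis using True by (simp add: tendsto_eventually)
  qed
  have "(\<lambda>n. \<integral>y. ?\<phi> n y \<partial>\<rho>) \<longlonglongrightarrow> (\<integral>y. indicator B y \<partial>\<rho>)"
  proof (rule integral_dominated_convergence[where w="\<lambda>_. 1"])
    show "AE y in \<rho>. norm (?\<phi> n y) \<le> 1" for n
      by (auto simp: infdist_nonneg min_def abs_mult field_simps)
    show "AE y in \<rho>. (\<lambda>n. ?\<phi> n y) \<longlonglongrightarrow> indicator B y" using lim borel_probs_space[OF r] by (intro AE_I2) simp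
    show "?\<phi> n \<in> borel_measurable \<rho>" for n
      by (intro borel_measurable_integrable borel_probs_integrable[OF Y r] continuous_intros)
  qed (use Bs in auto)
  then show ?thesis using Bs by simp
qed

text \<open>For the inclusion of the open sets: measures in the same cell (same integer parts of \<open>(n + 1) \<integral>\<phi>\<close> for all \<open>\<phi>\<close> in the \<open>n\<close>-th
  net) have distance at most \<open>3 / (n + 1)\<close>. The cells are countably many and measurable for the
  evaluations, and an open set is the union of the cells that it contains.\<close>

theorem sets_wasserstein_borel_eq_prob_algebra:
  fixes Y :: "'a::metric_space set"
  assumes Y: "compact Y"
  shows "sets (wasserstein_borel Y) = sets (prob_algebra (restrict_space borel Y))" (is "_ = sets ?P")
proof
  interpret W: Metric_space "borel_probs Y" "wasserstein Y" by (rule Metric_space_wasserstein[OF Y])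
  have bY: "Y \<in> sets borel" using Y by (simp add: compact_imp_closed)
  have "id \<in> wasserstein_borel Y \<rightarrow>\<^sub>M ?P"
  proof (rule measurable_prob_algebra_generated[OF sets_restrict_borel_openin[OF bY]])
    show "Int_stable {B. openin (top_of_set Y) B}" by (auto simp: Int_stable_def)
    show "{B. openin (top_of_set Y) B} \<subseteq> Pow Y" using openin_subset by fastforce
    fix B assume "B \<in> {B. openin (top_of_set Y) B}"
    then have B: "openin (top_of_set Y) B" by simp
    have "(\<lambda>\<rho>. measure \<rho> B) \<in> borel_measurable (wasserstein_borel Y)"
    proof (cases "B = Y")
      case True
      have "measure \<rho> B = 1" if "\<rho> \<in> borel_probs Y" for \<rho>
        using that prob_space.prob_space[of \<rho>] borel_probs_space[OF that] True by (simp add: borel_probs_def)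
      then show ?thesis by (subst measurable_cong[of _ _ "\<lambda>_. 1"]) (auto simp: space_wasserstein_borel)
    next
      case False
      show ?thesis
      proof (rule borel_measurable_LIMSEQ_real)
        show "(\<lambda>n. real (Suc n) * (\<integral>y. min (1 / real (Suc n)) (infdist y (Y - B)) \<partial>\<rho>)) \<longlonglongrightarrow> measure \<rho> B"
          if "\<rho> \<in> space (wasserstein_borel Y)" for \<rho>
          using that measure_relatively_open_limit[OF Y _ B False] by (simp add: space_wasserstein_borel)
        show "(\<lambda>\<rho>. real (Suc n) * (\<integral>y. min (1 / real (Suc n)) (infdist y (Y - B)) \<partial>\<rho>))
            \<in> borel_measurable (wasserstein_borel Y)" for n
        proof (intro borel_measurable_times borel_measurable_const measurable_lipschitz_integral_wasserstein[OF Y] lipschitz_onI)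
          fix x y
          show "dist (min (1 / real (Suc n)) (infdist x (Y - B))) (min (1 / real (Suc n)) (infdist y (Y - B))) \<le> 1 * dist x y"
            using infdist_triangle_abs[of x "Y - B" y] by (auto simp: dist_real_def min_def)
        qed simp
      qed
    qed
    then show "(\<lambda>\<rho>. emeasure (id \<rho>) B) \<in> borel_measurable (wasserstein_borel Y)"
      by (subst measurable_cong[of _ _ "\<lambda>\<rho>. ennreal (measure \<rho> B)"])
         (auto simp: space_wasserstein_borel borel_probs_def finite_measure.emeasure_eq_measure prob_space_def)
  qed (auto simp: space_wasserstein_borel borel_probs_def)
  from measurable_sets[OF this] show "sets ?P \<subseteq> sets (wasserstein_borel Y)"
    using sets.sets_into_space[of _ ?P] 
    by (fastforce simp: space_wasserstein_borel space_prob_algebra_restrict_borel Int_absorb2)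
next
  interpret W: Metric_space "borel_probs Y" "wasserstein Y" by (rule Metric_space_wasserstein[OF Y])
  have "\<exists>F. finite F \<and> (\<forall>\<phi>\<in>F. 1-lipschitz_on Y \<phi>) \<and>
      (\<forall>\<psi>. 1-lipschitz_on Y \<psi> \<longrightarrow> (\<exists>\<phi>\<in>F. \<exists>a. \<forall>y\<in>Y. \<bar>\<psi> y - \<phi> y - a\<bar> \<le> 1 / real (Suc n)))" for n
    by (rule finite_net_lipschitz[OF Y, of "1 / real (Suc n)"]) (simp, blast)
  then obtain F :: "nat \<Rightarrow> ('a \<Rightarrow> real) set" where F: "\<And>n. finite (F n)"
    "\<And>n \<phi>. \<phi> \<in> F n \<Longrightarrow> 1-lipschitz_on Y \<phi>"
    "\<And>n \<psi>. 1-lipschitz_on Y \<psi> \<Longrightarrow> \<exists>\<phi>\<in>F n. \<exists>a. \<forall>y\<in>Y. \<bar>\<psi> y - \<phi> y - a\<bar> \<le> 1 / real (Suc n)"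
    by metis
  define cell where "cell n v = {\<rho> \<in> borel_probs Y. \<forall>\<phi>\<in>F n. \<lfloor>real (Suc n) * (\<integral>y. \<phi> y \<partial>\<rho>)\<rfloor> = v \<phi>}"
    for n and v :: "('a \<Rightarrow> real) \<Rightarrow> int"
  define V where "V = (SIGMA n:UNIV. PiE (F n) (\<lambda>_. UNIV :: int set))"
  have V: "countable V" unfolding V_def by (intro countable_SIGMA countable_PiE F) auto
  have cell_sets: "cell n v \<in> sets ?P" for n v
  proof -
    have [measurable]: "(\<lambda>\<rho>. \<integral>y. \<phi> y \<partial>\<rho>) \<in> borel_measurable ?P" if "\<phi> \<in> F n" for \<phi>
      unfolding prob_algebra_def
      by (intro measurable_restrict_space1 integral_measurable_subprob_algebra
          borel_measurable_continuous_on_restrict lipschitz_on_continuous_on[OF F(2)[OF that]])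
    have "{\<rho> \<in> space ?P. \<forall>\<phi>\<in>F n. \<lfloor>real (Suc n) * (\<integral>y. \<phi> y \<partial>\<rho>)\<rfloor> = v \<phi>} \<in> sets ?P"
      by (intro sets.sets_Collect_finite_All' sets.sets_Collect_finite_All F) measurable
    then show ?thesis by (simp add: cell_def space_prob_algebra_restrict_borel)
  qed
  have small: "wasserstein Y \<rho> \<sigma> \<le> 3 * (1 / real (Suc n))" if "\<rho> \<in> cell n v" "\<sigma> \<in> cell n v" for \<rho> \<sigma> n v
  proof (rule wasserstein_leI[OF Y _ _ F(2) F(3)])
    fix \<phi> assume "\<phi> \<in> F n"
    then have "\<lfloor>real (Suc n) * (\<integral>y. \<phi> y \<partial>\<rho>)\<rfloor> = \<lfloor>real (Suc n) * (\<integral>y. \<phi> y \<partial>\<sigma>)\<rfloor>"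
      using that by (simp add: cell_def)
    then have "real (Suc n) * (\<integral>y. \<phi> y \<partial>\<rho>) - real (Suc n) * (\<integral>y. \<phi> y \<partial>\<sigma>) \<le> 1" by linarith
    then show "(\<integral>y. \<phi> y \<partial>\<rho>) - (\<integral>y. \<phi> y \<partial>\<sigma>) \<le> 1 / real (Suc n)"
      by (simp add: le_divide_eq algebra_simps del: of_nat_Suc)
  qed (use that in \<open>auto simp: cell_def\<close>)
  have "U \<in> sets ?P" if U: "openin W.mtopology U" for U
  proof -
    have "U \<subseteq> (\<Union>(n,v)\<in>{p \<in> V. case p of (n,v) \<Rightarrow> cell n v \<subseteq> U}. cell n v)"
    proof
      fix \<rho> assume r: "\<rho> \<in> U"
      then obtain e where e: "e > 0" "W.mball \<rho> e \<subseteq> U" using U unfolding W.openin_mtopology by blast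
      have rY: "\<rho> \<in> borel_probs Y" using U r unfolding W.openin_mtopology by blast
      obtain n where n: "1 / real (Suc n) < e / 3" using nat_approx_posE[of "e/3"] e by auto
      define v where "v = restrict (\<lambda>\<phi>. \<lfloor>real (Suc n) * (\<integral>y. \<phi> y \<partial>\<rho>)\<rfloor>) (F n)"
      have rc: "\<rho> \<in> cell n v" using rY by (simp add: cell_def v_def)
      have "cell n v \<subseteq> W.mball \<rho> e"
      proof
        fix \<sigma> assume s: "\<sigma> \<in> cell n v"
        show "\<sigma> \<in> W.mball \<rho> e"
          using small[OF rc s] s rY n by (auto simp: W.in_mball cell_def)
      qed
      moreover have "(n, v) \<in> V" by (simp add: V_def v_def)
      ultimately show "\<rho> \<in> (\<Union>(n,v)\<in>{p \<in> V. case p of (n,v) \<Rightarrow> cell n v \<subseteq> U}. cell n v)"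
        using rc e by blast
    qed
    then have "U = (\<Union>(n,v)\<in>{p \<in> V. case p of (n,v) \<Rightarrow> cell n v \<subseteq> U}. cell n v)" by blast
    also have "\<dots> \<in> sets ?P"
      by (intro sets.countable_UN'' countable_subset[OF _ V]) (auto simp: cell_sets)
    finally show ?thesis .
  qed
  then show "sets (wasserstein_borel Y) \<subseteq> sets ?P"
    unfolding sets_wasserstein_borel[OF Y]
    using sets.sigma_sets_subset[of "Collect (openin W.mtopology)" ?P]
    unfolding space_prob_algebra_restrict_borel by blast
qed

section \<open>Disintegration maps and their plans\<close>

lemma disintegration_map_iff_measurable:
  fixes X :: "'a::metric_space set" and Y :: "'b::metric_space set"
  assumes Y: "compact Y"
  shows "disintegration_map X Y f \<longleftrightarrow> f \<in> restrict_space borel X \<rightarrow>\<^sub>M wasserstein_borel Y"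
proof -
  let ?P = "prob_algebra (restrict_space borel Y)"
  have bY: "Y \<in> sets borel" using Y by (simp add: compact_imp_closed)
  note gen = sets_restrict_borel_openin[OF bY]
  have "disintegration_map X Y f \<longleftrightarrow> f \<in> restrict_space borel X \<rightarrow>\<^sub>M ?P"
  proof
    assume f: "disintegration_map X Y f"
    then have fp: "f x \<in> borel_probs Y" if "x \<in> X" for x
      using that by (auto simp: disintegration_map_def)
    show "f \<in> restrict_space borel X \<rightarrow>\<^sub>M ?P"
    proof (rule measurable_prob_algebra_generated[OF gen])
      show "Int_stable {B. openin (top_of_set Y) B}" by (auto simp: Int_stable_def)
      show "{B. openin (top_of_set Y) B} \<subseteq> Pow Y" using openin_subset by fastforce
      fix B assume "B \<in> {B. openin (top_of_set Y) B}"
      then have "(\<lambda>x. ennreal (measure (f x) B)) \<in> borel_measurable (restrict_space borel X)"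
        using f by (simp add: disintegration_map_def)
      moreover have "emeasure (f x) B = ennreal (measure (f x) B)" if "x \<in> X" for x
        using fp[OF that] by (simp add: borel_probs_def prob_space_def finite_measure.emeasure_eq_measure)
      ultimately show "(\<lambda>x. emeasure (f x) B) \<in> borel_measurable (restrict_space borel X)"
        by (subst measurable_cong[where g="\<lambda>x. ennreal (measure (f x) B)"]) (auto simp: space_restrict_space)
    qed (use fp in \<open>auto simp: space_restrict_space borel_probs_def\<close>)
  next
    assume f: "f \<in> restrict_space borel X \<rightarrow>\<^sub>M ?P"
    show "disintegration_map X Y f" unfolding disintegration_map_def
    proof (intro conjI allI impI)
      show "f \<in> X \<rightarrow> borel_probs Y"
        using measurable_space[OF f] by (auto simp: space_restrict_space space_prob_algebra_restrict_borel)
      fix B assume "openin (top_of_set Y) B"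
      then have "B \<in> sets (restrict_space borel Y)" unfolding gen by blast
      then show "(\<lambda>x. measure (f x) B) \<in> borel_measurable (restrict_space borel X)"
        by (rule measurable_compose[OF f measurable_measure_prob_algebra])
    qed
  qed
  then show ?thesis
    using measurable_cong_sets[OF refl sets_wasserstein_borel_eq_prob_algebra[OF Y]] by blast
qed

text \<open>The kernel \<open>x \<mapsto> distr (f x) _ (Pair x)\<close> is \<open>x \<mapsto> \<delta>\<^sub>x \<otimes> f x\<close>. The bind has the integrals
  prescribed for \<open>f \<otimes> \<mu>\<close>, and \<open>borel_probs_eqI\<close> gives the uniqueness that the definite description
  asks for.\<close>

lemma
  fixes X :: "'a::{metric_space,second_countable_topology} set"
    and Y :: "'b::{metric_space,second_countable_topology} set"
  assumes X: "compact X" and Y: "compact Y" and \<mu>: "\<mu> \<in> borel_probs X"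
    and f: "disintegration_map X Y f"
  shows disint_prod_eq_bind:
      "disint_prod X Y f \<mu> = \<mu> \<bind> (\<lambda>x. distr (f x) (restrict_space borel (X \<times> Y)) (Pair x))" (is ?eq)
    and nn_integral_disint_prod:
      "h \<in> borel_measurable (restrict_space borel (X \<times> Y)) \<Longrightarrow>
        (\<integral>\<^sup>+z. h z \<partial>disint_prod X Y f \<mu>) = (\<integral>\<^sup>+x. (\<integral>\<^sup>+y. h (x, y) \<partial>f x) \<partial>\<mu>)"
proof -
  let ?R = "restrict_space borel (X \<times> Y)"
  let ?P = "prob_algebra (restrict_space borel Y)"
  let ?K = "\<lambda>x. distr (f x) ?R (Pair x)"
  interpret \<mu>: prob_space \<mu> using \<mu> by (simp add: borel_probs_def)
  have s\<mu>: "sets \<mu> = sets (restrict_space borel X)" using \<mu> by (simp add: borel_probs_def)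
  have fP: "f \<in> \<mu> \<rightarrow>\<^sub>M ?P"
    using f disintegration_map_iff_measurable[OF Y]
      measurable_cong_sets[OF s\<mu> sets_wasserstein_borel_eq_prob_algebra[OF Y]] 
      measurable_cong_sets[OF s\<mu> refl] by blast
  have fx: "f x \<in> borel_probs Y" if "x \<in> X" for x using f that by (auto simp: disintegration_map_def)
  have pm: "Pair x \<in> f x \<rightarrow>\<^sub>M ?R" if "x \<in> X" for x
  proof -
    have "Pair x \<in> restrict_space borel Y \<rightarrow>\<^sub>M restrict_space borel X \<Otimes>\<^sub>M restrict_space borel Y"
      by (rule measurable_Pair1') (use that in \<open>simp add: space_restrict_space\<close>)
    then show ?thesis
      using fx[OF that] measurable_cong_sets[OF _ sets_pair_restrict_borel[of X Y], of "restrict_space borel Y" "f x"]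
      by (simp add: borel_probs_def)
  qed
  have K: "?K \<in> \<mu> \<rightarrow>\<^sub>M prob_algebra ?R"
  proof (rule measurable_distr_prob_space2[OF fP])
    have "sets (\<mu> \<Otimes>\<^sub>M restrict_space borel Y) = sets ?R"
      using sets_pair_measure_cong[OF s\<mu> refl] sets_pair_restrict_borel by blast
    then show "(\<lambda>(x, y). (x, y)) \<in> \<mu> \<Otimes>\<^sub>M restrict_space borel Y \<rightarrow>\<^sub>M ?R"
      using measurable_ident_sets by (simp add: id_def)
  qed
  note K' = measurable_prob_algebraD[OF K]
  let ?G = "\<mu> \<bind> ?K"
  have GP: "?G \<in> borel_probs (X \<times> Y)"
    using prob_space_bind'[OF _ K] sets_bind'[OF _ K] \<mu>.prob_space_axioms
    by (simp add: space_prob_algebra borel_probs_def)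
  have spX: "space \<mu> = X" by (rule borel_probs_space[OF \<mu>])
  have bnd: "bounded (\<phi> ` (X \<times> Y))" if "continuous_on (X \<times> Y) \<phi>" for \<phi> :: "'a \<times> 'b \<Rightarrow> real"
    using that X Y by (intro compact_imp_bounded compact_continuous_image compact_Times)
  have G: "(\<integral>z. \<phi> z \<partial>?G) = (\<integral>x. (\<integral>y. \<phi> (x, y) \<partial>f x) \<partial>\<mu>)"
    if \<phi>: "continuous_on (X \<times> Y) \<phi>" for \<phi> :: "'a \<times> 'b \<Rightarrow> real"
  proof -
    have \<phi>m: "\<phi> \<in> borel_measurable ?R" by (rule borel_measurable_continuous_on_restrict[OF \<phi>])
    obtain C where C: "\<And>z. z \<in> X \<times> Y \<Longrightarrow> \<bar>\<phi> z\<bar> \<le> C" using bnd[OF \<phi>] by (auto simp: bounded_iff)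
    have "(\<integral>z. \<phi> z \<partial>?G) = (\<integral>x. (\<integral>z. \<phi> z \<partial>?K x) \<partial>\<mu>)"
    proof (rule integral_bind[OF \<phi>m _ K', where B'=1])
      show "AE x in \<mu>. emeasure (?K x) (space (?K x)) \<le> ennreal 1"
        using measurable_space[OF K]
        by (intro AE_I2) (simp add: space_prob_algebra prob_space.emeasure_space_1 del: space_distr)
    qed (use C \<mu>.finite_measure_axioms in \<open>auto simp: space_restrict_space\<close>)
    also have "\<dots> = (\<integral>x. (\<integral>y. \<phi> (x, y) \<partial>f x) \<partial>\<mu>)"
      by (intro Bochner_Integration.integral_cong integral_distr pm \<phi>m) (auto simp: spX)
    finally show ?thesis .
  qed
  show eq: ?eq unfolding disint_prod_def
  proof (rule the_equality)
    fix \<gamma> assume \<gamma>: "\<gamma> \<in> borel_probs (X \<times> Y) \<and>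
        (\<forall>\<phi>::'a \<times> 'b \<Rightarrow> real. continuous_on (X \<times> Y) \<phi> \<and> bounded (\<phi> ` (X \<times> Y)) \<longrightarrow>
           (\<integral>z. \<phi> z \<partial>\<gamma>) = (\<integral>x. (\<integral>y. \<phi> (x, y) \<partial>f x) \<partial>\<mu>))"
    show "\<gamma> = ?G"
    proof (rule borel_probs_eqI[OF compact_Times[OF X Y] _ GP])
      fix \<phi> :: "'a \<times> 'b \<Rightarrow> real" assume "continuous_on (X \<times> Y) \<phi>"
      then show "(\<integral>z. \<phi> z \<partial>\<gamma>) = (\<integral>z. \<phi> z \<partial>?G)" using \<gamma> bnd G by simp
    qed (use \<gamma> in simp)
  qed (use GP G in simp)
  assume h: "h \<in> borel_measurable ?R"
  show "(\<integral>\<^sup>+z. h z \<partial>disint_prod X Y f \<mu>) = (\<integral>\<^sup>+x. (\<integral>\<^sup>+y. h (x, y) \<partial>f x) \<partial>\<mu>)"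
    unfolding eq nn_integral_bind[OF h K']
    by (intro nn_integral_cong nn_integral_distr pm) (auto simp: spX h)
qed

theorem proposition2p2:
  fixes X Y :: "(real ^ 'n) set"
    and \<mu> \<nu> :: "(real ^ 'n) measure"
    and c :: "(real ^ 'n) \<times> (real ^ 'n) \<Rightarrow> real"
    and \<Lambda> :: "(real ^ 'n) measure measure"
  assumes "compact X" and "compact Y"
    and "\<mu> \<in> borel_probs X" and "\<nu> \<in> borel_probs Y"
    and "\<And>x y. x \<in> X \<Longrightarrow> y \<in> Y \<Longrightarrow> 0 \<le> c (x, y)"
    and "c \<in> borel_measurable (restrict_space borel (X \<times> Y))"
    and "transport_class Y \<nu> \<Lambda>"
  shows "abstract_Monge Y (cost_tilde c) \<mu> \<Lambda> = MK_class X Y c \<mu> \<Lambda>"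
proof -
  have "sets \<mu> = sets (restrict_space borel X)" using assms(3) by (simp add: borel_probs_def)
  then have maps: "f \<in> \<mu> \<rightarrow>\<^sub>M wasserstein_borel Y \<longleftrightarrow> disintegration_map X Y f" for f
    using disintegration_map_iff_measurable[OF assms(2)] measurable_cong_sets[OF _ refl] by blast
  have cost: "(\<integral>\<^sup>+z. ennreal (c z) \<partial>disint_prod X Y f \<mu>) = (\<integral>\<^sup>+x. cost_tilde c x (f x) \<partial>\<mu>)"
    if "disintegration_map X Y f" for f
    unfolding cost_tilde_def
    by (rule nn_integral_disint_prod[OF assms(1-3) that]) (use assms(6) in measurable)
  have plans: "class_plans X Y \<mu> \<Lambda> = (\<lambda>f. disint_prod X Y f \<mu>) `
      {f. disintegration_map X Y f \<and> distr \<mu> (wasserstein_borel Y) f = \<Lambda>}"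
    by (auto simp: class_plans_def)
  show ?thesis
    unfolding abstract_Monge_def MK_class_def plans maps image_image
    by (intro INF_cong refl) (simp add: cost)
qed

end
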